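(* Let $s\ge1$ and $m\ge2$ be integers. Let $\overline\varepsilon_m>0$ be such that, for every $\delta\in[0,\overline\varepsilon_m]$ and every $w\le0$, one has $$\Phi_m^{\delta}(z)(z+w)\in[w,0]\ \text{ for all } z\in[-\ell_m^{\delta},0]\quad\Longleftrightarrow\quad (\Phi_m^{\delta})'(0)\,|w|\ge1 .$$ For $\varepsilon\ge0$ let $\varepsilon_m=\min\{\varepsilon,\overline\varepsilon_m\}$. Let $\lambda\le0$ and $\zeta<0$. Then for all $\tau>0$ and $\eta$ such that $$\tau|\zeta|\le\ell_s^{\varepsilon},\qquad \eta|\lambda|\le\ell_m^{\varepsilon_m},\qquad \eta\ge\frac{6\tau}{\ell_s^{\varepsilon}}\,\frac{m^2}{m^2-1},$$ one has $|R_{s,m}(\lambda,\zeta,\tau,\eta)|\le1$, i.e. the multirate Runge--Kutta--Chebyshev (mRKC) scheme is stable, where $$R_{s,m}(\lambda,\zeta,\tau,\eta)=R_s\big(\tau\,\Phi_m^{\varepsilon_m}(\eta\lambda)\,(\lambda+\zeta)\big)$$ is its stability polynomial.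
   Context: $T_k$ denotes the Chebyshev polynomial of the first kind of degree $k$. For an integer $k\ge1$ and a damping parameter $\delta\ge0$ put $x_{k}=1+\delta/k^2$, $x_{k}'=T_k(x_{k})/T_k'(x_{k})$, and define $$\ell_k^{\delta}=\frac{2x_{k}}{x_{k}'},\qquad P_k^{\delta}(z)=\frac{T_k(x_{k}+x_{k}'z)}{T_k(x_{k})},\qquad \Phi_k^{\delta}(z)=\frac{P_k^{\delta}(z)-1}{z}\ (z\ne0),\quad \Phi_k^{\delta}(0)=1 .$$ $R_s=P_s^{\varepsilon}$ is the stability polynomial of the outer $s$-stage RKC method with damping $\varepsilon$, and $P_m^{\varepsilon_m}$ is that of the inner $m$-stage RKC method with damping $\varepsilon_m$. When the mRKC scheme with step size $\tau$ and parameter $\eta$ is applied to the scalar multirate test equation $y'=\lambda y+\zeta y$ (fast part $f_F(y)=\lambda y$, slow part $f_S(y)=\zeta y$), one step reads $y_{n+1}=R_{s,m}(\lambda,\zeta,\tau,\eta)\,y_n$. *)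

theory Defs
  imports "HOL-Analysis.Analysis" "HOL-Computational_Algebra.Polynomial"
begin

fun cheb_T :: "nat \<Rightarrow> real poly" where
  "cheb_T 0 = 1"
| "cheb_T (Suc 0) = [:0, 1:]"
| "cheb_T (Suc (Suc n)) = [:0, 2:] * cheb_T (Suc n) - cheb_T n"

definition rkc_x :: "nat \<Rightarrow> real \<Rightarrow> real" where
  "rkc_x k \<delta> = 1 + \<delta> / real k ^ 2"

definition rkc_x' :: "nat \<Rightarrow> real \<Rightarrow> real" where
  "rkc_x' k \<delta> = poly (cheb_T k) (rkc_x k \<delta>) / poly (pderiv (cheb_T k)) (rkc_x k \<delta>)"

definition rkc_ell :: "nat \<Rightarrow> real \<Rightarrow> real" where
  "rkc_ell k \<delta> = 2 * rkc_x k \<delta> / rkc_x' k \<delta>"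

definition rkc_P :: "nat \<Rightarrow> real \<Rightarrow> real \<Rightarrow> real" where
  "rkc_P k \<delta> z =
     poly (cheb_T k) (rkc_x k \<delta> + rkc_x' k \<delta> * z) / poly (cheb_T k) (rkc_x k \<delta>)"

definition rkc_Phi :: "nat \<Rightarrow> real \<Rightarrow> real \<Rightarrow> real" where
  "rkc_Phi k \<delta> z = (if z = 0 then 1 else (rkc_P k \<delta> z - 1) / z)"

text \<open>Stages of one step of size \<open>h\<close> of the first-order \<open>k\<close>-stage Runge--Kutta--Chebyshev
  method with damping \<open>\<delta>\<close> for \<open>y' = f y\<close>, in the usual three-term form with
  \<open>b\<^sub>j = 1 / T\<^sub>j(x\<^sub>k)\<close> and coefficients \<open>\<mu>\<^sub>1 = x\<^sub>k' / x\<^sub>k\<close>, \<open>\<mu>\<^sub>j = 2 x\<^sub>k' b\<^sub>j / b\<^sub>j\<^sub>-\<^sub>1\<close>,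
  \<open>\<nu>\<^sub>j = 2 x\<^sub>k b\<^sub>j / b\<^sub>j\<^sub>-\<^sub>1\<close>, \<open>\<kappa>\<^sub>j = - b\<^sub>j / b\<^sub>j\<^sub>-\<^sub>2\<close> (\<open>j \<ge> 2\<close>).\<close>

definition rkc_b :: "nat \<Rightarrow> real \<Rightarrow> nat \<Rightarrow> real" where
  "rkc_b k \<delta> j = 1 / poly (cheb_T j) (rkc_x k \<delta>)"

fun rkc_stage ::
  "nat \<Rightarrow> real \<Rightarrow> real \<Rightarrow> ('a::real_vector \<Rightarrow> 'a) \<Rightarrow> 'a \<Rightarrow> nat \<Rightarrow> 'a" where
  "rkc_stage k \<delta> h f y 0 = y"
| "rkc_stage k \<delta> h f y (Suc 0) = y + (rkc_x' k \<delta> / rkc_x k \<delta> * h) *\<^sub>R f y"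
| "rkc_stage k \<delta> h f y (Suc (Suc j)) =
     (2 * rkc_x k \<delta> * rkc_b k \<delta> (Suc (Suc j)) / rkc_b k \<delta> (Suc j))
         *\<^sub>R rkc_stage k \<delta> h f y (Suc j)
   + (- rkc_b k \<delta> (Suc (Suc j)) / rkc_b k \<delta> j) *\<^sub>R rkc_stage k \<delta> h f y j
   + (2 * rkc_x' k \<delta> * rkc_b k \<delta> (Suc (Suc j)) / rkc_b k \<delta> (Suc j) * h)
         *\<^sub>R f (rkc_stage k \<delta> h f y (Suc j))"

definition rkc_step ::
  "nat \<Rightarrow> real \<Rightarrow> real \<Rightarrow> ('a::real_vector \<Rightarrow> 'a) \<Rightarrow> 'a \<Rightarrow> 'a" where
  "rkc_step k \<delta> h f y = rkc_stage k \<delta> h f y k"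

text \<open>The averaged force at \<open>y\<close> is \<open>(u\<^sub>\<eta> - y) / \<eta>\<close>, where \<open>u\<^sub>\<eta>\<close> is one inner RKC step of size \<open>\<eta>\<close>
  for the auxiliary problem \<open>u' = f\<^sub>F u + f\<^sub>S y\<close>, \<open>u 0 = y\<close>, with the slow force frozen at \<open>y\<close>
  (only \<open>\<eta> \<noteq> 0\<close> is meaningful). The mRKC scheme applies the outer RKC step to it.\<close>

definition averaged_force ::
  "nat \<Rightarrow> real \<Rightarrow> real \<Rightarrow> ('a::real_vector \<Rightarrow> 'a) \<Rightarrow> ('a \<Rightarrow> 'a) \<Rightarrow> 'a \<Rightarrow> 'a" where
  "averaged_force m \<delta> \<eta> fF fS y = (1 / \<eta>) *\<^sub>R (rkc_step m \<delta> \<eta> (\<lambda>u. fF u + fS y) y - y)"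

definition mrkc_step ::
  "nat \<Rightarrow> nat \<Rightarrow> real \<Rightarrow> real \<Rightarrow> real \<Rightarrow> real \<Rightarrow>
     ('a::real_vector \<Rightarrow> 'a) \<Rightarrow> ('a \<Rightarrow> 'a) \<Rightarrow> 'a \<Rightarrow> 'a" where
  "mrkc_step s m \<epsilon> \<epsilon>m \<tau> \<eta> fF fS y = rkc_step s \<epsilon> \<tau> (averaged_force m \<epsilon>m \<eta> fF fS) y"

definition mrkc_R ::
  "nat \<Rightarrow> nat \<Rightarrow> real \<Rightarrow> real \<Rightarrow> real \<Rightarrow> real \<Rightarrow> real \<Rightarrow> real \<Rightarrow> real" where
  "mrkc_R s m \<epsilon> \<epsilon>m lam zet \<tau> \<eta> = rkc_P s \<epsilon> (\<tau> * rkc_Phi m \<epsilon>m (\<eta> * lam) * (lam + zet))"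

end

theory Submission
  imports Defs
begin

text \<open>On a linear problem the inner and outer stages are explicit Chebyshev quotients, so stability
  reduces to \<open>\<tau> \<Phi>(\<eta>\<lambda>)(\<lambda> + \<zeta>) \<in> [-\<ell>\<^sub>s, 0]\<close>. The assumed equivalence, used with the extreme value
  \<open>w = -\<eta> \<ell>\<^sub>s / \<tau>\<close>, yields this once \<open>\<Phi>'(0) \<ge> (m\<^sup>2 - 1) / (6 m\<^sup>2)\<close>. Now \<open>\<Phi>'(0) = T T'' / (2 T'\<^sup>2)\<close> at
  \<open>x\<^sub>m \<ge> 1\<close>, and \<open>T T'' - c T'\<^sup>2\<close> with \<open>c = (m\<^sup>2 - 1) / (3 m\<^sup>2)\<close> vanishes at \<open>1\<close> and has derivative
  \<open>T T''' + (1 - 2 c) T' T''\<close>, which is nonnegative on \<open>[1, \<infinity>)\<close> because the Taylor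
  coefficients of \<open>T\<close> at \<open>1\<close> are nonnegative and \<open>c < 1/2\<close>.\<close>

section \<open>Polynomials with nonnegative Taylor coefficients at 1\<close>

text \<open>Composing with \<open>[:1, 1:]\<close> re-expands \<open>p\<close> in powers of
  \<open>x - 1\<close>. The class is closed under sums, products and derivatives, and its members
  are nonnegative and increasing on \<open>x \<ge> 1\<close>.\<close>

definition nonneg_coeffs_at_1 :: "real poly \<Rightarrow> bool" where
  "nonneg_coeffs_at_1 p \<longleftrightarrow> (\<forall>i. 0 \<le> coeff (pcompose p [:1, 1:]) i)"

lemma nonneg_coeffs_at_1_add:
  "nonneg_coeffs_at_1 p \<Longrightarrow> nonneg_coeffs_at_1 q \<Longrightarrow> nonneg_coeffs_at_1 (p + q)"
  by (simp add: nonneg_coeffs_at_1_def pcompose_add)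

lemma nonneg_coeffs_at_1_mult:
  "nonneg_coeffs_at_1 p \<Longrightarrow> nonneg_coeffs_at_1 q \<Longrightarrow> nonneg_coeffs_at_1 (p * q)"
  by (auto simp: nonneg_coeffs_at_1_def pcompose_mult coeff_mult intro!: sum_nonneg)

lemma nonneg_coeffs_at_1_pderiv:
  assumes "nonneg_coeffs_at_1 p"
  shows "nonneg_coeffs_at_1 (pderiv p)"
proof -
  have "pcompose (pderiv p) [:1, 1:] = pderiv (pcompose p [:1, 1:])"
    by (simp add: pderiv_pcompose pderiv_pCons)
  then show ?thesis
    using assms by (simp add: nonneg_coeffs_at_1_def coeff_pderiv)
qed

lemma poly_mono_nonneg_coeffs_at_1:
  assumes p: "nonneg_coeffs_at_1 p" and "1 \<le> x" "x \<le> y"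
  shows "poly p x \<le> poly p y"
proof -
  let ?q = "pcompose p [:1, 1:]"
  have "poly ?q (x - 1) \<le> poly ?q (y - 1)"
    unfolding poly_altdef using assms
    by (intro sum_mono mult_left_mono power_mono) (auto simp: nonneg_coeffs_at_1_def)
  then show ?thesis by (simp add: poly_pcompose)
qed

lemma poly_nonneg_coeffs_at_1:
  assumes p: "nonneg_coeffs_at_1 p" and x: "1 \<le> x"
  shows "0 \<le> poly p x"
proof -
  have "0 \<le> poly p 1"
    using p by (auto simp: nonneg_coeffs_at_1_def poly_pcompose simp flip: poly_0_coeff_0 dest: spec[of _ 0])
  then show ?thesis
    using poly_mono_nonneg_coeffs_at_1[OF p _ x] by simp
qed

text \<open>The increments satisfy \<open>T\<^sub>n\<^sub>+\<^sub>2 - T\<^sub>n\<^sub>+\<^sub>1 = 2 (x - 1) T\<^sub>n\<^sub>+\<^sub>1 + (T\<^sub>n\<^sub>+\<^sub>1 - T\<^sub>n)\<close>.\<close>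

lemma nonneg_coeffs_at_1_cheb_T_and_increment:
  "nonneg_coeffs_at_1 (cheb_T n) \<and> nonneg_coeffs_at_1 (cheb_T (Suc n) - cheb_T n)"
proof (induction n)
  case 0
  then show ?case
    by (auto simp: nonneg_coeffs_at_1_def pcompose_1 pcompose_pCons pcompose_diff coeff_pCons
        split: nat.split)
next
  case (Suc n)
  have T: "nonneg_coeffs_at_1 (cheb_T (Suc n))"
    using nonneg_coeffs_at_1_add[of "cheb_T n" "cheb_T (Suc n) - cheb_T n"] Suc by simp
  have "nonneg_coeffs_at_1 [:-2, 2:]"
    by (auto simp: nonneg_coeffs_at_1_def pcompose_pCons coeff_pCons split: nat.split)
  then have "nonneg_coeffs_at_1 ([:-2, 2:] * cheb_T (Suc n) + (cheb_T (Suc n) - cheb_T n))"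
    using Suc T by (intro nonneg_coeffs_at_1_add nonneg_coeffs_at_1_mult) auto
  moreover have "[:-2, 2:] * cheb_T (Suc n) + (cheb_T (Suc n) - cheb_T n)
      = cheb_T (Suc (Suc n)) - cheb_T (Suc n)"
    by (rule poly_eqI) (simp add: coeff_pCons algebra_simps split: nat.split)
  ultimately show ?case using T by metis
qed

lemma nonneg_coeffs_at_1_cheb_T: "nonneg_coeffs_at_1 (cheb_T n)"
  using nonneg_coeffs_at_1_cheb_T_and_increment by blast

section \<open>Chebyshev polynomials: values at 1 and bounds\<close>

lemma poly_cheb_T_1: "poly (cheb_T n) 1 = 1"
  by (induction n rule: cheb_T.induct) auto

lemma poly_pderiv_cheb_T_1: "poly (pderiv (cheb_T n)) 1 = (real n)\<^sup>2"
  by (induction n rule: cheb_T.induct)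
    (auto simp: pderiv_mult pderiv_diff pderiv_smult pderiv_pCons poly_cheb_T_1 power2_eq_square algebra_simps)

lemma poly_pderiv2_cheb_T_1:
  "3 * poly (pderiv (pderiv (cheb_T n))) 1 = (real n)\<^sup>2 * ((real n)\<^sup>2 - 1)"
proof (induction n rule: cheb_T.induct)
  case (3 n)
  have "poly (pderiv (pderiv (cheb_T (Suc (Suc n))))) 1
      = 4 * (real (Suc n))\<^sup>2 + 2 * poly (pderiv (pderiv (cheb_T (Suc n)))) 1
        - poly (pderiv (pderiv (cheb_T n))) 1"
    by (simp add: pderiv_mult pderiv_diff pderiv_add pderiv_smult pderiv_pCons poly_pderiv_cheb_T_1)
  then show ?case using 3 by (simp add: power2_eq_square algebra_simps)
qed (auto simp: pderiv_pCons)

lemma cheb_T_ge_1: "1 \<le> x \<Longrightarrow> 1 \<le> poly (cheb_T n) x"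
  using poly_mono_nonneg_coeffs_at_1[OF nonneg_coeffs_at_1_cheb_T[of n], of 1 x]
  by (simp add: poly_cheb_T_1)

lemma pderiv_cheb_T_pos:
  assumes "1 \<le> n" "1 \<le> x"
  shows "0 < poly (pderiv (cheb_T n)) x"
proof -
  have "(real n)\<^sup>2 \<le> poly (pderiv (cheb_T n)) x"
    using poly_mono_nonneg_coeffs_at_1
      [OF nonneg_coeffs_at_1_pderiv[OF nonneg_coeffs_at_1_cheb_T[of n]], of 1 x] assms
    by (simp add: poly_pderiv_cheb_T_1)
  moreover have "0 < (real n)\<^sup>2" using assms by simp
  ultimately show ?thesis by linarith
qed

lemma poly_cheb_T_cos: "poly (cheb_T n) (cos t) = cos (real n * t)"
proof (induction n rule: cheb_T.induct)
  case (3 n)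
  have "cos (real (Suc (Suc n)) * t) + cos (real n * t) = 2 * cos t * cos (real (Suc n) * t)"
    using cos_add[of "real (Suc n) * t" t] cos_diff[of "real (Suc n) * t" t]
    by (simp add: algebra_simps)
  then show ?case using 3 by simp
qed auto

lemma poly_cheb_T_minus: "poly (cheb_T n) (- x) = (-1) ^ n * poly (cheb_T n) x"
  by (induction n rule: cheb_T.induct) (auto simp: algebra_simps)

text \<open>On \<open>[-1, 1]\<close> the cosine form gives the bound 1, which is at most
  \<open>T_n(x)\<close>. Outside, parity reduces to \<open>\<bar>y\<bar> > 1\<close>, where
  \<open>T_n\<close> is increasing.\<close>

lemma abs_cheb_T_le:
  assumes "1 \<le> x" "\<bar>y\<bar> \<le> x"
  shows "\<bar>poly (cheb_T n) y\<bar> \<le> poly (cheb_T n) x"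
proof (cases "\<bar>y\<bar> \<le> 1")
  case True
  then have "poly (cheb_T n) y = cos (real n * arccos y)"
    by (simp add: cos_arccos_abs flip: poly_cheb_T_cos)
  then have "\<bar>poly (cheb_T n) y\<bar> \<le> 1" by simp
  then show ?thesis using cheb_T_ge_1[OF assms(1), of n] by linarith
next
  case False
  have "\<bar>poly (cheb_T n) y\<bar> = \<bar>poly (cheb_T n) \<bar>y\<bar>\<bar>"
    by (simp add: abs_if[of y] poly_cheb_T_minus abs_mult power_abs)
  moreover have "1 \<le> poly (cheb_T n) \<bar>y\<bar>"
    using False by (intro cheb_T_ge_1) simp
  moreover have "poly (cheb_T n) \<bar>y\<bar> \<le> poly (cheb_T n) x"
    using False assms by (intro poly_mono_nonneg_coeffs_at_1 nonneg_coeffs_at_1_cheb_T) auto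
  ultimately show ?thesis by linarith
qed

lemma cheb_T_second_derivative_bound:
  assumes n: "1 \<le> n" and x: "1 \<le> x"
  defines "c \<equiv> ((real n)\<^sup>2 - 1) / (3 * (real n)\<^sup>2)"
  shows "c * (poly (pderiv (cheb_T n)) x)\<^sup>2
      \<le> poly (cheb_T n) x * poly (pderiv (pderiv (cheb_T n))) x"
proof -
  define p where "p = cheb_T n"
  define g where "g = p * pderiv (pderiv p) - smult c (pderiv p * pderiv p)"
  have n2: "0 < (real n)\<^sup>2" using n by simp
  have c: "c \<le> 1 / 2"
    using n2 by (simp add: c_def field_simps)
  have g': "poly (pderiv g) y = poly p y * poly (pderiv (pderiv (pderiv p))) y
      + (1 - 2 * c) * (poly (pderiv p) y * poly (pderiv (pderiv p)) y)" for y
    by (simp add: g_def pderiv_diff pderiv_mult pderiv_smult algebra_simps)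
  have p: "nonneg_coeffs_at_1 p"
    by (simp add: p_def nonneg_coeffs_at_1_cheb_T)
  note p' = nonneg_coeffs_at_1_pderiv[OF p]
  note p'' = nonneg_coeffs_at_1_pderiv[OF p']
  note p''' = nonneg_coeffs_at_1_pderiv[OF p'']
  have "0 \<le> poly (pderiv g) y" if "1 \<le> y" for y
    unfolding g' using c that p p' p'' p'''
    by (intro add_nonneg_nonneg mult_nonneg_nonneg poly_nonneg_coeffs_at_1) auto
  then have "poly g 1 \<le> poly g x"
    by (intro DERIV_nonneg_imp_nondecreasing[OF x]) (blast intro: poly_DERIV)
  moreover have "poly g 1 = 0"
  proof -
    \<comment> \<open>The constant \<open>c\<close> is the value of \<open>T T'' / T'^2\<close> at
      1, where \<open>T = 1\<close>, \<open>T' = n^2\<close> and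
      \<open>3 T'' = n^2 (n^2 - 1)\<close>.\<close>
    have "c * (3 * (real n)\<^sup>2) = (real n)\<^sup>2 - 1" using n2 by (simp add: c_def)
    then have "3 * poly (pderiv (pderiv p)) 1 = (real n)\<^sup>2 * (c * (3 * (real n)\<^sup>2))"
      using poly_pderiv2_cheb_T_1[of n] by (simp add: p_def)
    then show ?thesis by (simp add: g_def p_def poly_cheb_T_1 poly_pderiv_cheb_T_1)
  qed
  ultimately show ?thesis
    by (simp add: g_def p_def power2_eq_square)
qed

section \<open>RKC stability interval and the derivative of \<open>rkc_Phi\<close> at 0\<close>

lemma rkc_x_ge_1: "0 \<le> \<delta> \<Longrightarrow> 1 \<le> rkc_x k \<delta>"
  by (simp add: rkc_x_def)

lemma rkc_x'_pos: "1 \<le> k \<Longrightarrow> 0 \<le> \<delta> \<Longrightarrow> 0 < rkc_x' k \<delta>"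
  unfolding rkc_x'_def
  by (intro divide_pos_pos pderiv_cheb_T_pos order.strict_trans2[OF zero_less_one cheb_T_ge_1]
      rkc_x_ge_1)

lemma rkc_ell_pos: "1 \<le> k \<Longrightarrow> 0 \<le> \<delta> \<Longrightarrow> 0 < rkc_ell k \<delta>"
  using rkc_x'_pos[of k \<delta>] rkc_x_ge_1[of \<delta> k] by (simp add: rkc_ell_def)

text \<open>The length \<open>rkc_ell\<close> is chosen so that \<open>x + x' z\<close> sweeps
  \<open>[-x, x]\<close>, where \<open>T_k\<close> is bounded by \<open>T_k(x)\<close>.\<close>

lemma abs_rkc_P_le_1:
  assumes k: "1 \<le> k" and \<delta>: "0 \<le> \<delta>" and z: "- rkc_ell k \<delta> \<le> z" "z \<le> 0"
  shows "\<bar>rkc_P k \<delta> z\<bar> \<le> 1"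
proof -
  let ?x = "rkc_x k \<delta>" and ?x' = "rkc_x' k \<delta>"
  have x': "0 < ?x'" using rkc_x'_pos k \<delta> .
  have "?x' * (- rkc_ell k \<delta>) \<le> ?x' * z" "?x' * z \<le> 0"
    using x' z mult_left_mono[of "- rkc_ell k \<delta>" z ?x'] by (auto simp: mult_le_0_iff)
  moreover have "?x' * rkc_ell k \<delta> = 2 * ?x" using x' by (simp add: rkc_ell_def)
  ultimately have "\<bar>?x + ?x' * z\<bar> \<le> ?x" by (simp add: abs_le_iff)
  from abs_cheb_T_le[OF rkc_x_ge_1[OF \<delta>] this, of k] cheb_T_ge_1[OF rkc_x_ge_1[OF \<delta>], of k k]
  show ?thesis by (simp add: rkc_P_def divide_le_eq)
qed

text \<open>Writing \<open>P(z) = 1 + z + z\<^sup>2 r(z)\<close> gives \<open>\<Phi>(z) = 1 + z r(z)\<close>, hence \<open>\<Phi>'(0) = r(0) = P''(0) / 2\<close>.\<close>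

lemma deriv_rkc_Phi_0:
  assumes k: "1 \<le> k" and \<delta>: "0 \<le> \<delta>"
  shows "deriv (rkc_Phi k \<delta>) 0 =
    poly (cheb_T k) (rkc_x k \<delta>) * poly (pderiv (pderiv (cheb_T k))) (rkc_x k \<delta>)
      / (2 * (poly (pderiv (cheb_T k)) (rkc_x k \<delta>))\<^sup>2)"
proof -
  let ?x = "rkc_x k \<delta>" and ?x' = "rkc_x' k \<delta>"
  define T where "T = poly (cheb_T k) ?x"
  define T1 where "T1 = poly (pderiv (cheb_T k)) ?x"
  define T2 where "T2 = poly (pderiv (pderiv (cheb_T k))) ?x"
  define Q where "Q = smult (1 / T) (pcompose (cheb_T k) [:?x, ?x':])"
  have T: "0 < T" unfolding T_def using cheb_T_ge_1[OF rkc_x_ge_1[OF \<delta>], of k k] by linarith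
  have T1: "0 < T1" unfolding T1_def using pderiv_cheb_T_pos[OF k rkc_x_ge_1[OF \<delta>]] .
  have x': "?x' = T / T1" by (simp add: rkc_x'_def T_def T1_def)
  have Q: "poly Q z = rkc_P k \<delta> z" for z
    by (simp add: Q_def rkc_P_def poly_pcompose T_def mult.commute)
  have Q0: "poly Q 0 = 1"
    using T by (simp add: Q_def poly_pcompose T_def)
  have Q1: "poly (pderiv Q) 0 = 1"
    using T T1 x' by (simp add: Q_def pderiv_smult pderiv_pcompose pderiv_pCons poly_pcompose T1_def)
  have Q2: "poly (pderiv (pderiv Q)) 0 = T * T2 / T1\<^sup>2"
    using T T1
    by (simp add: Q_def pderiv_smult pderiv_pcompose pderiv_mult pderiv_pCons poly_pcompose T2_def
        x' power2_eq_square)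
  obtain a b r where r: "Q = pCons a (pCons b r)" by (metis pCons_cases)
  have a: "a = 1" using Q0 r by simp
  have b: "b = 1" using Q1 r by (simp add: pderiv_pCons)
  have r0: "poly r 0 = T * T2 / (2 * T1\<^sup>2)" using Q2 r by (simp add: pderiv_pCons pderiv_add field_simps)
  \<comment> \<open>The separately defined value 1 at \<open>z = 0\<close> agrees with the constant
    coefficient \<open>b = 1\<close>, so the equality holds at every point and
    \<open>rkc_Phi\<close> is a polynomial.\<close>
  have "rkc_Phi k \<delta> = poly (pCons 1 r)"
    by (rule ext) (simp add: rkc_Phi_def r a b field_simps flip: Q)
  then have "deriv (rkc_Phi k \<delta>) 0 = poly r 0"
    by (simp add: DERIV_imp_deriv[OF poly_DERIV] pderiv_pCons)
  then show ?thesis using r0 by (simp add: T_def T1_def T2_def)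
qed

text \<open>Half of the Chebyshev constant \<open>c\<close>. Its reciprocal is the factor
  \<open>6 m^2 / (m^2 - 1)\<close> in the condition on \<open>\<eta>\<close>.\<close>

lemma deriv_rkc_Phi_0_ge:
  assumes k: "1 \<le> k" and \<delta>: "0 \<le> \<delta>"
  shows "((real k)\<^sup>2 - 1) / (6 * (real k)\<^sup>2) \<le> deriv (rkc_Phi k \<delta>) 0"
  unfolding deriv_rkc_Phi_0[OF k \<delta>]
  using cheb_T_second_derivative_bound[OF k rkc_x_ge_1[OF \<delta>, of k]]
    pderiv_cheb_T_pos[OF k rkc_x_ge_1[OF \<delta>, of k]] k
  by (simp add: field_simps)

section \<open>Closed forms of the RKC stages and of the averaged force\<close>

text \<open>Measured from the equilibrium \<open>- g / a\<close>, the problem is homogeneous, and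
  the stage recurrence becomes the Chebyshev recurrence at \<open>x + x' h a\<close>, normalised by
  \<open>T_j(x)\<close>.\<close>

lemma rkc_stage_affine:
  assumes \<delta>: "0 \<le> \<delta>" and a: "a \<noteq> 0"
  shows "rkc_stage k \<delta> h (\<lambda>u. a * u + g) y j =
    poly (cheb_T j) (rkc_x k \<delta> + rkc_x' k \<delta> * (h * a)) / poly (cheb_T j) (rkc_x k \<delta>) * (y + g / a)
      - g / a"
proof (induction j rule: cheb_T.induct)
  case 1
  then show ?case by simp
next
  case 2
  have "rkc_x k \<delta> > 0" using rkc_x_ge_1[OF \<delta>, of k] by linarith
  then show ?case using a by (simp add: field_simps)
next
  case (3 j)
  have pos: "poly (cheb_T i) (rkc_x k \<delta>) \<noteq> 0" for i
    using cheb_T_ge_1[OF rkc_x_ge_1[OF \<delta>], of i k] by linarith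
  define A B C x x' v w where "A = poly (cheb_T j) (rkc_x k \<delta>)"
    and "B = poly (cheb_T (Suc j)) (rkc_x k \<delta>)"
    and "C = poly (cheb_T (Suc (Suc j))) (rkc_x k \<delta>)"
    and "x = rkc_x k \<delta>" and "x' = rkc_x' k \<delta>"
    and "v = poly (cheb_T j) (rkc_x k \<delta> + rkc_x' k \<delta> * (h * a))"
    and "w = poly (cheb_T (Suc j)) (rkc_x k \<delta> + rkc_x' k \<delta> * (h * a))"
  note defs = A_def B_def C_def x_def x'_def v_def w_def
  have nz: "A \<noteq> 0" "B \<noteq> 0" "C \<noteq> 0" using pos by (auto simp only: defs)
  have C: "C = 2 * x * B - A" by (simp add: defs algebra_simps)
  define p r Y G where "p = w / B" and "r = v / A" and "Y = y + g / a" and "G = g / a"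
  note quots = p_def r_def Y_def G_def
  have wv: "w = p * B" "v = r * A" using nz by (simp_all add: p_def r_def)
  have f: "a * (p * Y - G) + g = a * (p * Y)" using a by (simp add: G_def right_diff_distrib)
  have "rkc_stage k \<delta> h (\<lambda>u. a * u + g) y (Suc (Suc j))
      = 2 * x * (B / C) * (p * Y - G) - A / C * (r * Y - G)
        + 2 * x' * (B / C) * h * (a * (p * Y - G) + g)"
    unfolding rkc_stage.simps 3 by (simp add: rkc_b_def defs quots del: cheb_T.simps)
  also have "\<dots> = (2 * (x + x' * (h * a)) * w - v) / C * Y - (2 * x * B - A) / C * G"
    unfolding f wv by (simp only: divide_inverse) (simp add: algebra_simps)
  \<comment> \<open>The two stage weights add up to \<open>(2 x B - A) / C = 1\<close>, so the
    equilibrium is preserved.\<close>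
  also have "\<dots> = (2 * (x + x' * (h * a)) * w - v) / C * Y - G"
    using nz(3) by (simp flip: C)
  finally show ?case by (simp add: defs Y_def G_def mult.assoc)
qed

text \<open>This is the limit \<open>a \<rightarrow> 0\<close> of the affine formula, which divides
  by \<open>a\<close>: the difference quotient of \<open>T_j\<close> turns into its
  derivative.\<close>

lemma rkc_stage_const:
  fixes y g :: real
  assumes \<delta>: "0 \<le> \<delta>"
  shows "rkc_stage k \<delta> h (\<lambda>u. g) y j =
    y + rkc_x' k \<delta> * poly (pderiv (cheb_T j)) (rkc_x k \<delta>) / poly (cheb_T j) (rkc_x k \<delta>) * h * g"
proof (induction j rule: cheb_T.induct)
  case 1
  then show ?case by simp
next
  case 2
  then show ?case by (simp add: pderiv_pCons)
next
  case (3 j)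
  have pos: "poly (cheb_T i) (rkc_x k \<delta>) \<noteq> 0" for i
    using cheb_T_ge_1[OF rkc_x_ge_1[OF \<delta>], of i k] by linarith
  define A B C x x' v w where "A = poly (cheb_T j) (rkc_x k \<delta>)"
    and "B = poly (cheb_T (Suc j)) (rkc_x k \<delta>)"
    and "C = poly (cheb_T (Suc (Suc j))) (rkc_x k \<delta>)"
    and "x = rkc_x k \<delta>" and "x' = rkc_x' k \<delta>"
    and "v = poly (pderiv (cheb_T j)) (rkc_x k \<delta>)"
    and "w = poly (pderiv (cheb_T (Suc j))) (rkc_x k \<delta>)"
  note defs = A_def B_def C_def x_def x'_def v_def w_def
  have nz: "A \<noteq> 0" "B \<noteq> 0" "C \<noteq> 0" using pos by (auto simp only: defs)
  have C: "C = 2 * x * B - A" by (simp add: defs algebra_simps)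
  define p r where "p = w / B" and "r = v / A"
  have wv: "w = p * B" "v = r * A" using nz by (simp_all add: p_def r_def)
  \<comment> \<open>Differentiating the recurrence adds \<open>2 B\<close>, which is exactly the
    contribution of the force term.\<close>
  have T': "poly (pderiv (cheb_T (Suc (Suc j)))) x = 2 * B + 2 * x * w - v"
    by (simp add: defs pderiv_diff pderiv_mult pderiv_smult pderiv_pCons algebra_simps)
  have "rkc_stage k \<delta> h (\<lambda>u. g) y (Suc (Suc j))
      = 2 * x * (B / C) * (y + x' * p * h * g) - A / C * (y + x' * r * h * g)
        + 2 * x' * (B / C) * h * g"
    unfolding rkc_stage.simps 3 by (simp add: rkc_b_def defs p_def r_def del: cheb_T.simps)
  also have "\<dots> = (2 * x * B - A) / C * y + x' * (2 * B + 2 * x * w - v) / C * h * g"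
    unfolding wv by (simp only: divide_inverse) (simp add: algebra_simps)
  also have "\<dots> = y + x' * (2 * B + 2 * x * w - v) / C * h * g"
    using nz(3) by (simp flip: C)
  finally show ?case unfolding T'[symmetric] by (simp only: defs)
qed

lemma rkc_step_linear:
  fixes y :: real
  assumes \<delta>: "0 \<le> \<delta>"
  shows "rkc_step k \<delta> h (\<lambda>u. a * u) y = rkc_P k \<delta> (h * a) * y"
proof (cases "a = 0")
  case True
  have "poly (cheb_T k) (rkc_x k \<delta>) \<noteq> 0"
    using cheb_T_ge_1[OF rkc_x_ge_1[OF \<delta>], of k k] by linarith
  then show ?thesis
    using True rkc_stage_const[OF \<delta>, of k h 0 y k] by (simp add: rkc_step_def rkc_P_def)
next
  case False
  then show ?thesis
    using rkc_stage_affine[OF \<delta> False, of k h 0 y k] by (simp add: rkc_step_def rkc_P_def)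
qed

lemma averaged_force_linear:
  assumes k: "1 \<le> k" and \<delta>: "0 \<le> \<delta>" and \<eta>: "\<eta> \<noteq> 0"
  shows "averaged_force k \<delta> \<eta> (\<lambda>u. a * u) (\<lambda>u. b * u) = (\<lambda>y. rkc_Phi k \<delta> (\<eta> * a) * (a + b) * y)"
proof
  fix y
  show "averaged_force k \<delta> \<eta> (\<lambda>u. a * u) (\<lambda>u. b * u) y = rkc_Phi k \<delta> (\<eta> * a) * (a + b) * y"
  proof (cases "a = 0")
    case True
    have T: "poly (cheb_T k) (rkc_x k \<delta>) \<noteq> 0"
      using cheb_T_ge_1[OF rkc_x_ge_1[OF \<delta>], of k k] by linarith
    have T': "poly (pderiv (cheb_T k)) (rkc_x k \<delta>) \<noteq> 0"
      using pderiv_cheb_T_pos[OF k rkc_x_ge_1[OF \<delta>, of k]] by linarith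
    \<comment> \<open>The choice \<open>x' = T / T'\<close> makes the coefficient of the force equal
      to 1, matching \<open>rkc_Phi\<close> at 0.\<close>
    have "rkc_step k \<delta> \<eta> (\<lambda>u. b * y) y = y + \<eta> * (b * y)"
      using rkc_stage_const[OF \<delta>, of k \<eta> "b * y" y k] T T'
      by (simp add: rkc_step_def rkc_x'_def)
    then show ?thesis using True \<eta> by (simp add: averaged_force_def rkc_Phi_def)
  next
    case False
    have "rkc_step k \<delta> \<eta> (\<lambda>u. a * u + b * y) y = rkc_P k \<delta> (\<eta> * a) * (y + b * y / a) - b * y / a"
      using rkc_stage_affine[OF \<delta> False, of k \<eta> "b * y" y k]
      by (simp add: rkc_step_def rkc_P_def)
    then have "rkc_step k \<delta> \<eta> (\<lambda>u. a * u + b * y) y - y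
        = (rkc_P k \<delta> (\<eta> * a) - 1) * ((a + b) * y / a)"
      using False by (simp add: add_divide_distrib algebra_simps)
    then show ?thesis using False \<eta> by (simp add: averaged_force_def rkc_Phi_def)
  qed
qed

section \<open>Stability of the multirate scheme\<close>

theorem theorem4p5:
  fixes s m :: nat
    and \<epsilon>bar \<epsilon> \<epsilon>m lam zet \<tau> \<eta> :: real
  assumes "s \<ge> 1" and "m \<ge> 2"
    and "\<epsilon>bar > 0"
    and "\<And>\<delta> w :: real. \<delta> \<in> {0..\<epsilon>bar} \<Longrightarrow> w \<le> 0 \<Longrightarrow>
           (\<forall>z \<in> {- rkc_ell m \<delta>..0}. rkc_Phi m \<delta> z * (z + w) \<in> {w..0})
             \<longleftrightarrow> deriv (rkc_Phi m \<delta>) 0 * \<bar>w\<bar> \<ge> 1"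
    and "\<epsilon> \<ge> 0" and "\<epsilon>m = min \<epsilon> \<epsilon>bar"
    and "lam \<le> 0" and "zet < 0" and "\<tau> > 0"
    and "\<tau> * \<bar>zet\<bar> \<le> rkc_ell s \<epsilon>"
    and "\<eta> * \<bar>lam\<bar> \<le> rkc_ell m \<epsilon>m"
    and "\<eta> \<ge> 6 * \<tau> / rkc_ell s \<epsilon> * ((real m)\<^sup>2 / ((real m)\<^sup>2 - 1))"
  shows "(\<forall>y :: real. mrkc_step s m \<epsilon> \<epsilon>m \<tau> \<eta> (\<lambda>u. lam * u) (\<lambda>u. zet * u) y
                        = mrkc_R s m \<epsilon> \<epsilon>m lam zet \<tau> \<eta> * y)
         \<and> \<bar>mrkc_R s m \<epsilon> \<epsilon>m lam zet \<tau> \<eta>\<bar> \<le> 1"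
proof -
  have \<epsilon>m: "0 \<le> \<epsilon>m" "\<epsilon>m \<in> {0..\<epsilon>bar}" using assms by auto
  have m: "1 \<le> m" using assms by simp
  define L where "L = rkc_ell s \<epsilon>"
  have L: "0 < L" unfolding L_def using assms by (intro rkc_ell_pos)
  define q where "q = (real m)\<^sup>2"
  have "2\<^sup>2 \<le> q" unfolding q_def using assms by (intro power_mono) auto
  then have q: "1 < q" by simp
  have \<eta>_ge: "6 * \<tau> / L * (q / (q - 1)) \<le> \<eta>" using assms by (simp add: L_def q_def)
  moreover have "0 < 6 * \<tau> / L * (q / (q - 1))" using L q assms by simp
  ultimately have \<eta>: "0 < \<eta>" by linarith
  \<comment> \<open>Scaling by \<open>\<tau> / \<eta>\<close> sends \<open>w\<close> to
    \<open>- L\<close>, the left end of the outer stability interval; the bound on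
    \<open>\<tau> * \<bar>zet\<bar>\<close> says \<open>w \<le> \<eta> * zet\<close>.\<close>
  define w where "w = - (\<eta> * L / \<tau>)"
  have w: "w < 0" using \<eta> L assms by (simp add: w_def)
  have "6 * q / (q - 1) \<le> \<bar>w\<bar>"
    using \<eta>_ge \<eta> L q assms by (simp add: w_def field_simps)
  then have "(q - 1) / (6 * q) * (6 * q / (q - 1)) \<le> deriv (rkc_Phi m \<epsilon>m) 0 * \<bar>w\<bar>"
    using deriv_rkc_Phi_0_ge[OF m \<epsilon>m(1)] q by (intro mult_mono') (auto simp: q_def)
  then have "1 \<le> deriv (rkc_Phi m \<epsilon>m) 0 * \<bar>w\<bar>" using q by simp
  then have inner: "\<forall>z \<in> {- rkc_ell m \<epsilon>m..0}. rkc_Phi m \<epsilon>m z * (z + w) \<in> {w..0}"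
    using assms(4)[OF \<epsilon>m(2), of w] w by auto
  define z where "z = \<eta> * lam"
  define F where "F = rkc_Phi m \<epsilon>m z"
  have z: "z \<le> 0" "- rkc_ell m \<epsilon>m \<le> z"
    using assms \<eta> by (auto simp: z_def mult_le_0_iff)
  then have Fw: "w \<le> F * (z + w)" "F * (z + w) \<le> 0"
    using inner by (auto simp: F_def)
  \<comment> \<open>Here \<open>z + w\<close> is strictly negative, so the upper bound in
    \<open>Fw\<close> fixes the sign of \<open>F\<close>.\<close>
  then have F: "0 \<le> F" using w z by (auto simp: mult_le_0_iff)
  have "- L / \<tau> \<le> zet" using assms by (simp add: L_def field_simps)
  then have "\<eta> * (- L / \<tau>) \<le> \<eta> * zet" using \<eta> by (intro mult_left_mono) auto
  then have "w \<le> \<eta> * zet" by (simp add: w_def)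
  \<comment> \<open>With \<open>F\<close> nonnegative, replacing \<open>w\<close> by the larger
    \<open>\<eta> * zet\<close> keeps the lower bound, so the extreme slow term controls the actual
    one.\<close>
  then have "F * (z + w) \<le> F * (\<eta> * (lam + zet))"
    using F by (intro mult_left_mono) (auto simp: z_def algebra_simps)
  with Fw have "w \<le> F * (\<eta> * (lam + zet))" by linarith
  then have "\<tau> / \<eta> * w \<le> \<tau> / \<eta> * (F * (\<eta> * (lam + zet)))"
    using \<eta> assms by (intro mult_left_mono) auto
  then have "- L \<le> \<tau> * F * (lam + zet)"
    using \<eta> assms(9) by (simp add: w_def mult.assoc)
  moreover have "\<tau> * F * (lam + zet) \<le> 0"
    using F assms by (intro mult_nonneg_nonpos) auto
  ultimately have "\<bar>mrkc_R s m \<epsilon> \<epsilon>m lam zet \<tau> \<eta>\<bar> \<le> 1"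
    unfolding mrkc_R_def using assms by (intro abs_rkc_P_le_1) (auto simp: L_def F_def z_def)
  moreover have "mrkc_step s m \<epsilon> \<epsilon>m \<tau> \<eta> (\<lambda>u. lam * u) (\<lambda>u. zet * u) y
      = mrkc_R s m \<epsilon> \<epsilon>m lam zet \<tau> \<eta> * y" for y :: real
    unfolding mrkc_step_def mrkc_R_def averaged_force_linear[OF m \<epsilon>m(1) less_imp_neq[OF \<eta>, symmetric]]
    using rkc_step_linear[OF assms(5)] by (simp add: mult.assoc)
  ultimately show ?thesis by blast
qed

end
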